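(* For every fixed integer $k\ge 3$ (and every positive integer $n$), $$g(n,K_{2k-1},C_{2k})=0.$$
   Context: Constructor--Blocker game: given graphs $H$ and $F$, two players, Constructor and Blocker, alternately claim one previously unclaimed edge of the complete graph $K_n$, with Constructor moving first. The graph formed by Constructor's edges must remain $F$-free (contain no subgraph isomorphic to $F$, not necessarily induced) throughout the game, so Constructor may not claim an edge that would create a copy of $F$; Blocker plays without restriction. The game ends when all edges are claimed or Constructor has no legal move. Constructor aims to maximize the number of copies of $H$ (subgraphs isomorphic to $H$) in her final graph and Blocker aims to minimize it; $g(n,H,F)$ denotes this number under optimal play by both players. $C_\ell$ is the cycle of length $\ell$ and $K_r$ the complete graph on $r$ vertices. *)

theory Defs
  imports Main
begin

text \<open>A graph is a pair of a vertex set and a set of edges, every edge being a set of two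
  distinct vertices.\<close>

type_synonym 'a graph = "'a set \<times> 'a set set"

abbreviation verts :: "'a graph \<Rightarrow> 'a set" where "verts \<equiv> fst"

abbreviation edges :: "'a graph \<Rightarrow> 'a set set" where "edges \<equiv> snd"

definition all_edges :: "'a set \<Rightarrow> 'a set set" where
  "all_edges V = {e. e \<subseteq> V \<and> card e = 2}"

definition simple_graph :: "'a graph \<Rightarrow> bool" where
  "simple_graph G \<longleftrightarrow> finite (verts G) \<and> edges G \<subseteq> all_edges (verts G)"

definition subgraph :: "'a graph \<Rightarrow> 'a graph \<Rightarrow> bool" where
  "subgraph S G \<longleftrightarrow> simple_graph S \<and> verts S \<subseteq> verts G \<and> edges S \<subseteq> edges G"

definition graph_iso :: "'a graph \<Rightarrow> 'b graph \<Rightarrow> bool" where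
  "graph_iso G H \<longleftrightarrow>
     (\<exists>f. bij_betw f (verts G) (verts H) \<and> (\<lambda>e. f ` e) ` edges G = edges H)"

definition copies :: "'h graph \<Rightarrow> 'a graph \<Rightarrow> 'a graph set" where
  "copies H G = {S. subgraph S G \<and> graph_iso H S}"

definition is_free :: "'f graph \<Rightarrow> 'a graph \<Rightarrow> bool" where
  "is_free F G \<longleftrightarrow> copies F G = {}"

definition complete_graph :: "nat \<Rightarrow> nat graph" where
  "complete_graph r = ({..<r}, all_edges {..<r})"

text \<open>Meaningful as a cycle only for \<open>l \<ge> 3\<close>.\<close>

definition cycle_graph :: "nat \<Rightarrow> nat graph" where
  "cycle_graph l = ({..<l}, {{i, (i + 1) mod l} | i. i < l})"

text \<open>Positions of the game on \<open>K\<^sub>n\<close> are pairs \<open>C\<close>, \<open>B\<close>: the edges claimed so far by Constructor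
  and by Blocker.\<close>

definition unclaimed :: "nat \<Rightarrow> nat set set \<Rightarrow> nat set set \<Rightarrow> nat set set" where
  "unclaimed n C B = edges (complete_graph n) - (C \<union> B)"

definition legal_moves ::
  "'f graph \<Rightarrow> nat \<Rightarrow> nat set set \<Rightarrow> nat set set \<Rightarrow> nat set set" where
  "legal_moves F n C B = {e \<in> unclaimed n C B. is_free F ({..<n}, insert e C)}"

lemma finite_unclaimed [simp]: "finite (unclaimed n C B)"
  by (rule finite_subset[of _ "Pow {..<n}"])
    (auto simp: unclaimed_def complete_graph_def all_edges_def)

lemma finite_legal_moves [simp]: "finite (legal_moves F n C B)"
  by (simp add: legal_moves_def)

lemma card_unclaimed_insert_left:
  "e \<in> unclaimed n C B \<Longrightarrow> card (unclaimed n (insert e C) B) < card (unclaimed n C B)"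
  by (rule psubset_card_mono[OF finite_unclaimed]) (auto simp: unclaimed_def)

lemma card_unclaimed_insert_right:
  "e \<in> unclaimed n C B \<Longrightarrow> card (unclaimed n C (insert e B)) < card (unclaimed n C B)"
  by (rule psubset_card_mono[OF finite_unclaimed]) (auto simp: unclaimed_def)

text \<open>Minimax value of a position with Constructor, respectively Blocker, to move. If Constructor
  has no legal move while it is Blocker's turn, further Blocker moves leave \<open>C\<close> unchanged and
  legal moves never reappear, so letting Blocker still move does not affect the value.\<close>

function constructor_value ::
    "'h graph \<Rightarrow> 'f graph \<Rightarrow> nat \<Rightarrow> nat set set \<Rightarrow> nat set set \<Rightarrow> nat"
  and blocker_value ::
    "'h graph \<Rightarrow> 'f graph \<Rightarrow> nat \<Rightarrow> nat set set \<Rightarrow> nat set set \<Rightarrow> nat" where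
  "constructor_value H F n C B =
     (if legal_moves F n C B = {} then card (copies H ({..<n}, C))
      else Max ((\<lambda>e. blocker_value H F n (insert e C) B) ` legal_moves F n C B))"
| "blocker_value H F n C B =
     (if unclaimed n C B = {} then card (copies H ({..<n}, C))
      else Min ((\<lambda>e. constructor_value H F n C (insert e B)) ` unclaimed n C B))"
  by pat_completeness auto
termination
  by (relation "measure (case_sum (\<lambda>(H, F, n, C, B). card (unclaimed n C B))
                                  (\<lambda>(H, F, n, C, B). card (unclaimed n C B)))")
    (auto simp: legal_moves_def card_unclaimed_insert_left card_unclaimed_insert_right)

declare constructor_value.simps [simp del] blocker_value.simps [simp del]

definition game_value :: "nat \<Rightarrow> 'h graph \<Rightarrow> 'f graph \<Rightarrow> nat" where
  "game_value n H F = constructor_value H F n {} {}"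

end

theory Submission
  imports Defs
begin

text \<open>
  Write \<open>r = 2k - 1 \<ge> 5\<close>, so that the forbidden cycle has length \<open>r + 1\<close>. Call a set of \<open>r\<close>
  vertices a \<^emph>\<open>threat\<close> if Constructor owns all of its edges but at most one and Blocker owns none.
  Blocker wins by answering every threat as soon as it appears, and this works because one
  Constructor move creates at most one threat.

  Indeed, a set that becomes a threat contains both ends of the edge just claimed, so two new
  threats \<open>S\<close> and \<open>T\<close> would share at least two vertices. Then some vertex \<open>v\<close> of \<open>T\<close> outside \<open>S\<close> is
  joined to two vertices \<open>u\<close>, \<open>w\<close> of \<open>S\<close> (lemma \<open>two_common_neighbours\<close>), and since a complete graph on
  at least five vertices stays Hamilton-connected when an edge is deleted (lemma
  \<open>hamiltonian_path_near_complete\<close>), a path from \<open>u\<close> to \<open>w\<close> through all of \<open>S\<close> closes up through \<open>v\<close> to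
  a cycle of length \<open>r + 1\<close>. Constructor is not allowed to own such a cycle.

  Hence Blocker can keep the position free of threats whenever Constructor is to move
  (\<open>constructor_safe\<close>); from such a position Constructor cannot complete a clique with one move.
\<close>

section \<open>Cycles and cliques as copies\<close>

lemma cycle_not_free:
  assumes "finite V" "distinct xs" "set xs \<subseteq> V" "length xs \<ge> 2"
    and path: "successively (\<lambda>x y. {x, y} \<in> E) xs"
    and closing: "{last xs, hd xs} \<in> E"
  shows "\<not> is_free (cycle_graph (length xs)) (V, E)"
proof -
  let ?l = "length xs"
  define D where "D = {{xs ! i, xs ! ((i + 1) mod ?l)} | i. i < ?l}"
  have D_edge: "{xs ! i, xs ! ((i + 1) mod ?l)} \<in> E \<inter> all_edges (set xs)" if "i < ?l" for i
  proof -
    have ne: "xs ! i \<noteq> xs ! ((i + 1) mod ?l)"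
    proof (cases "i + 1 = ?l")
      case True
      have "xs \<noteq> []" using \<open>length xs \<ge> 2\<close> by auto
      moreover have "i \<noteq> 0" using True assms(4) by auto
      ultimately show ?thesis using True that \<open>distinct xs\<close> by (simp add: nth_eq_iff_index_eq)
    next
      case False
      then show ?thesis using that \<open>distinct xs\<close> by (simp add: nth_eq_iff_index_eq)
    qed
    have "{xs ! i, xs ! ((i + 1) mod ?l)} \<in> E"
    proof (cases "i + 1 = ?l")
      case True
      have "xs \<noteq> []" using \<open>length xs \<ge> 2\<close> by auto
      moreover have "i = ?l - 1" using True by simp
      ultimately show ?thesis using True closing by (simp add: last_conv_nth hd_conv_nth)
    next
      case False
      then show ?thesis using that path by (simp add: successively_conv_nth)
    qed
    moreover have "(i + 1) mod ?l < ?l" using that by (intro mod_less_divisor) linarith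
    ultimately show ?thesis using that ne by (auto simp: all_edges_def card_insert_if)
  qed
  have "subgraph (set xs, D) (V, E)"
    unfolding subgraph_def simple_graph_def D_def using assms(3) D_edge by auto
  moreover have "graph_iso (cycle_graph ?l) (set xs, D)"
    unfolding graph_iso_def
  proof (intro exI conjI)
    show "bij_betw ((!) xs) (verts (cycle_graph ?l)) (verts (set xs, D))"
      using \<open>distinct xs\<close> by (auto simp: cycle_graph_def intro: bij_betw_nth)
    show "(\<lambda>e. (!) xs ` e) ` edges (cycle_graph ?l) = edges (set xs, D)"
      unfolding cycle_graph_def D_def by (auto simp: image_iff) (metis image_empty image_insert)
  qed
  ultimately show ?thesis
    unfolding is_free_def copies_def by blast
qed

lemma copy_of_complete_graph:
  assumes "T \<in> copies (complete_graph r) (V, E)"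
  shows "verts T \<subseteq> V" "card (verts T) = r" "all_edges (verts T) \<subseteq> E"
proof -
  obtain f where f: "bij_betw f {..<r} (verts T)"
    and img: "(\<lambda>e. f ` e) ` all_edges {..<r} = edges T"
    using assms by (auto simp: copies_def graph_iso_def complete_graph_def)
  show "verts T \<subseteq> V" using assms by (auto simp: copies_def subgraph_def)
  show "card (verts T) = r" using bij_betw_same_card[OF f] by simp
  have "all_edges (verts T) \<subseteq> edges T"
  proof
    fix e assume e: "e \<in> all_edges (verts T)"
    then obtain d where d: "d \<subseteq> {..<r}" "e = f ` d"
      using f by (metis (no_types, lifting) all_edges_def bij_betw_def mem_Collect_eq
          subset_image_iff)
    moreover have "card d = card e"
      using f d by (metis bij_betw_def card_image inj_on_subset)
    ultimately have "d \<in> all_edges {..<r}" using e by (auto simp: all_edges_def)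
    then show "e \<in> edges T" using img d by blast
  qed
  then show "all_edges (verts T) \<subseteq> E"
    using assms by (auto simp: copies_def subgraph_def)
qed

section \<open>Cliques missing at most one edge\<close>

text \<open>Complete sets are included: the exceptional pair may lie in \<open>E\<close>, and it may be degenerate.\<close>

definition near_complete :: "'a set set \<Rightarrow> 'a set \<Rightarrow> bool" where
  "near_complete E S \<longleftrightarrow> (\<exists>a b. all_edges S \<subseteq> insert {a, b} E)"

lemma pair_in_all_edges: "x \<in> S \<Longrightarrow> y \<in> S \<Longrightarrow> x \<noteq> y \<Longrightarrow> {x, y} \<in> all_edges S"
  by (auto simp: all_edges_def)

lemma ex_member_outside:
  assumes "finite F" "card F < card S"
  obtains x where "x \<in> S" "x \<notin> F"
  using assms by (metis card_mono leD subsetI)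

lemma successively_of_distinct:
  assumes "distinct xs"
    and "\<And>x y. x \<in> set xs \<Longrightarrow> y \<in> set xs \<Longrightarrow> x \<noteq> y \<Longrightarrow> P x y"
  shows "successively P xs"
  using assms by (auto simp: successively_conv_nth nth_eq_iff_index_eq)

text \<open>The only trouble is a missing edge \<open>{a, b}\<close> inside \<open>S\<close>. Since \<open>u\<close> is not on it, an end \<open>s \<noteq> w\<close> of
  it can be visited directly after \<open>u\<close> and followed by a vertex \<open>c\<close> off the missing edge; the rest of the path
  avoids \<open>s\<close>, so it may run in any order.\<close>

lemma hamiltonian_path_from_outside:
  assumes "finite S" "card S \<ge> 5" and sub: "all_edges S \<subseteq> insert {a, b} E"
    and uw: "u \<in> S" "w \<in> S" "u \<noteq> w" and u: "u \<notin> {a, b}"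
  shows "\<exists>xs. distinct xs \<and> set xs = S \<and> successively (\<lambda>x y. {x, y} \<in> E) xs \<and>
           hd xs = u \<and> last xs = w"
proof -
  define M where "M = S - {u, w}"
  have cardM: "card M \<ge> 3"
    unfolding M_def using assms by (simp add: card_Diff_subset)
  have E: "{x, y} \<in> E" if "x \<in> S" "y \<in> S" "x \<noteq> y" "{x, y} \<noteq> {a, b}" for x y
    using pair_in_all_edges[OF that(1-3)] that(4) sub by auto
  have "\<exists>s c. s \<in> M \<and> c \<in> M \<and> c \<noteq> s \<and> c \<notin> {a, b} \<and>
          (\<forall>x\<in>S - {u}. \<forall>y\<in>S - {u}. x \<noteq> y \<longrightarrow> {x, y} = {a, b} \<longrightarrow> s \<in> {x, y})"
  proof (cases "a \<in> M \<or> b \<in> M")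
    case True
    have "card {a, b} < card M" using cardM card_insert_le_m1[of 2 "{b}" a] by simp
    then obtain c where "c \<in> M" "c \<notin> {a, b}" by (rule ex_member_outside[rotated]) auto
    then show ?thesis using True
      by (intro exI[of _ "if a \<in> M then a else b"] exI[of _ c]) (auto simp: doubleton_eq_iff)
  next
    case False
    obtain s where s: "s \<in> M" using cardM by (metis card.empty ex_in_conv not_numeral_le_zero)
    have "card {s} < card M" using cardM by simp
    then obtain c where "c \<in> M" "c \<notin> {s}" by (rule ex_member_outside[rotated]) auto
    then show ?thesis using s False uw unfolding M_def
      by (intro exI[of _ s] exI[of _ c]) (auto simp: doubleton_eq_iff)
  qed
  then obtain s c where sc: "s \<in> M" "c \<in> M" "c \<noteq> s" "c \<notin> {a, b}"
    and s: "\<And>x y. x \<in> S - {u} \<Longrightarrow> y \<in> S - {u} \<Longrightarrow> x \<noteq> y \<Longrightarrow> {x, y} = {a, b} \<Longrightarrow> s \<in> {x, y}"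
    by blast
  obtain rest where rest: "distinct rest" "set rest = M - {s, c}"
    using finite_distinct_list[of "M - {s, c}"] \<open>finite S\<close> unfolding M_def by auto
  define tail where "tail = c # rest @ [w]"
  have tail: "distinct tail" "set tail = S - {u, s}"
    using rest sc uw unfolding tail_def M_def by auto
  have "successively (\<lambda>x y. {x, y} \<in> E) tail"
  proof (rule successively_of_distinct[OF tail(1)])
    fix x y assume "x \<in> set tail" "y \<in> set tail" "x \<noteq> y"
    then show "{x, y} \<in> E" using s[of x y] tail(2) by (intro E) blast+
  qed
  moreover have "{u, s} \<in> E" using sc uw u unfolding M_def by (intro E) auto
  moreover have "{s, c} \<in> E" using sc unfolding M_def by (intro E) auto
  ultimately have "successively (\<lambda>x y. {x, y} \<in> E) (u # s # tail)"
    by (simp add: tail_def)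
  moreover have "distinct (u # s # tail)" "set (u # s # tail) = S"
    using tail sc uw unfolding M_def by auto
  moreover have "hd (u # s # tail) = u" "last (u # s # tail) = w"
    unfolding tail_def by auto
  ultimately show ?thesis by blast
qed

text \<open>Five vertices are needed: if \<open>{a, b}\<close> is missing from a complete graph on \<open>{a, b, u, w}\<close>, then
  \<open>a\<close> and \<open>b\<close> are adjacent in every Hamilton path from \<open>u\<close> to \<open>w\<close>.\<close>

lemma hamiltonian_path_near_complete:
  assumes "finite S" "card S \<ge> 5" "near_complete E S" and uw: "u \<in> S" "w \<in> S" "u \<noteq> w"
  shows "\<exists>xs. distinct xs \<and> set xs = S \<and> successively (\<lambda>x y. {x, y} \<in> E) xs \<and>
           hd xs = u \<and> last xs = w"
proof -
  obtain a b where sub: "all_edges S \<subseteq> insert {a, b} E"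
    using assms by (auto simp: near_complete_def)
  consider "u \<notin> {a, b}" | "w \<notin> {a, b}" | "{a, b} = {u, w}" using uw by auto
  then show ?thesis
  proof cases
    case 1
    show ?thesis using hamiltonian_path_from_outside[OF assms(1,2) sub uw 1] .
  next
    case 2
    from hamiltonian_path_from_outside[OF assms(1,2) sub uw(2,1) uw(3)[symmetric] 2]
    obtain xs where xs: "distinct xs" "set xs = S" "successively (\<lambda>x y. {x, y} \<in> E) xs"
      "hd xs = w" "last xs = u" by blast
    then have "successively (\<lambda>x y. {x, y} \<in> E) (rev xs)"
      by (simp add: insert_commute)
    moreover have "xs \<noteq> []" using xs uw by auto
    ultimately show ?thesis using xs by (intro exI[of _ "rev xs"]) (simp add: hd_rev last_rev)
  next
    case 3
    have E: "{x, y} \<in> E" if "x \<in> S" "y \<in> S" "x \<noteq> y" "{x, y} \<noteq> {u, w}" for x y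
      using pair_in_all_edges[OF that(1-3)] that(4) sub 3 by auto
    have "card {u, w} < card S" using assms(2) uw by simp
    then obtain c where c: "c \<in> S" "c \<notin> {u, w}" by (rule ex_member_outside[rotated]) auto
    obtain rest where rest: "distinct rest" "set rest = S - {u, w, c}"
      using finite_distinct_list[of "S - {u, w, c}"] \<open>finite S\<close> by auto
    have "successively (\<lambda>x y. {x, y} \<in> E) (c # rest @ [w])"
      using rest c uw by (intro successively_of_distinct E) (auto simp: doubleton_eq_iff)
    moreover have "{u, c} \<in> E" using c uw by (intro E) (auto simp: doubleton_eq_iff)
    ultimately show ?thesis
      using rest c uw by (intro exI[of _ "u # c # rest @ [w]"]) auto
  qed
qed

text \<open>If some vertex of \<open>T\<close> outside \<open>S\<close> avoids the missing edge of \<open>T\<close>, it is joined to the given common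
  vertices \<open>p\<close> and \<open>q\<close>. Otherwise all vertices of \<open>T\<close> off the missing edge, at least three, lie in \<open>S\<close>
  and are joined to everything in \<open>T\<close>.\<close>

lemma two_common_neighbours:
  assumes "finite T" "card T \<ge> 5" "near_complete E T" "\<not> T \<subseteq> S"
    and pq: "p \<in> S \<inter> T" "q \<in> S \<inter> T" "p \<noteq> q"
  obtains u v w where "v \<in> T - S" "u \<in> S" "w \<in> S" "u \<noteq> w" "{u, v} \<in> E" "{w, v} \<in> E"
proof -
  obtain a b where sub: "all_edges T \<subseteq> insert {a, b} E"
    using assms by (auto simp: near_complete_def)
  have E: "{x, y} \<in> E" if "x \<in> T" "y \<in> T" "x \<noteq> y" "x \<notin> {a, b} \<or> y \<notin> {a, b}" for x y
    using pair_in_all_edges[OF that(1-3)] that(4) sub by auto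
  show thesis
  proof (cases "T - S \<subseteq> {a, b}")
    case False
    then obtain v where "v \<in> T - S" "v \<notin> {a, b}" by auto
    then show thesis using that[of v p q] E[of p v] E[of q v] pq by auto
  next
    case True
    obtain v where v: "v \<in> T - S" using assms by auto
    have "card {a, b} < card T" using assms(2) card_insert_le_m1[of 2 "{b}" a] by simp
    then obtain u where u: "u \<in> T" "u \<notin> {a, b}" by (rule ex_member_outside[rotated]) auto
    have "card {u, a, b} < card T"
      using assms(2) card_insert_le_m1[of 3 "{a, b}" u] card_insert_le_m1[of 2 "{b}" a] by simp
    then obtain w where w: "w \<in> T" "w \<notin> {u, a, b}" by (rule ex_member_outside[rotated]) auto
    show thesis using that[of v u w] E[of u v] E[of w v] u v w True by auto
  qed
qed

lemma near_complete_unique: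
  assumes free: "is_free (cycle_graph (Suc r)) (V, E)" and "finite V" "r \<ge> 5"
    and S: "S \<subseteq> V" "card S = r" "near_complete E S"
    and T: "T \<subseteq> V" "card T = r" "near_complete E T"
    and pq: "p \<in> S \<inter> T" "q \<in> S \<inter> T" "p \<noteq> q"
  shows "S = T"
proof (rule ccontr)
  assume "S \<noteq> T"
  have fin: "finite S" "finite T" using S T \<open>finite V\<close> finite_subset by auto
  then have "\<not> T \<subseteq> S" using S T \<open>S \<noteq> T\<close> card_subset_eq by metis
  moreover have "card T \<ge> 5" using T \<open>r \<ge> 5\<close> by simp
  ultimately obtain u v w
    where uvw: "v \<in> T - S" "u \<in> S" "w \<in> S" "u \<noteq> w" "{u, v} \<in> E" "{w, v} \<in> E"
    using two_common_neighbours[OF fin(2) _ T(3) _ pq] by blast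
  obtain xs where xs: "distinct xs" "set xs = S" "successively (\<lambda>x y. {x, y} \<in> E) xs"
    "hd xs = u" "last xs = w"
    using hamiltonian_path_near_complete[OF fin(1) _ S(3) uvw(2-4)] S \<open>r \<ge> 5\<close> by auto
  have "length xs = r" using xs S distinct_card by metis
  moreover have "\<not> is_free (cycle_graph (length (v # xs))) (V, E)"
  proof (rule cycle_not_free)
    show "successively (\<lambda>x y. {x, y} \<in> E) (v # xs)"
      using xs uvw by (cases xs) (auto simp: insert_commute)
    show "{last (v # xs), hd (v # xs)} \<in> E" using xs uvw by auto
  qed (use xs uvw S T \<open>finite V\<close> \<open>length xs = r\<close> \<open>r \<ge> 5\<close> in auto)
  ultimately show False using free by simp
qed

section \<open>Blocker's strategy\<close>

definition live :: "nat \<Rightarrow> nat \<Rightarrow> nat set set \<Rightarrow> nat set \<Rightarrow> bool" where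
  "live r n B S \<longleftrightarrow> S \<subseteq> {..<n} \<and> card S = r \<and> all_edges S \<inter> B = {}"

definition constructor_safe :: "nat \<Rightarrow> nat \<Rightarrow> nat set set \<Rightarrow> nat set set \<Rightarrow> bool" where
  "constructor_safe r n C B \<longleftrightarrow> C \<inter> B = {} \<and> (\<forall>S. live r n B S \<longrightarrow> \<not> near_complete C S)"

definition blocker_safe :: "nat \<Rightarrow> nat \<Rightarrow> nat set set \<Rightarrow> nat set set \<Rightarrow> bool" where
  "blocker_safe r n C B \<longleftrightarrow> C \<inter> B = {} \<and> (\<forall>S. live r n B S \<longrightarrow> \<not> all_edges S \<subseteq> C) \<and>
     (\<forall>S T. live r n B S \<longrightarrow> near_complete C S \<longrightarrow> live r n B T \<longrightarrow> near_complete C T \<longrightarrow> S = T)"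

lemma constructor_safe_imp_blocker_safe:
  assumes "constructor_safe r n C B"
  shows "blocker_safe r n C B"
  using assms unfolding constructor_safe_def blocker_safe_def near_complete_def by blast

lemma blocker_safe_no_copies:
  assumes "blocker_safe r n C B"
  shows "copies (complete_graph r) ({..<n}, C) = {}"
proof (rule equals0I)
  fix T assume T: "T \<in> copies (complete_graph r) ({..<n}, C)"
  have "live r n B (verts T)"
    using copy_of_complete_graph[OF T] assms by (auto simp: live_def blocker_safe_def)
  then show False
    using copy_of_complete_graph(3)[OF T] assms by (auto simp: blocker_safe_def)
qed

lemma constructor_move_safe:
  assumes "r \<ge> 5" and safe: "constructor_safe r n C B"
    and e: "e \<in> legal_moves (cycle_graph (Suc r)) n C B"
  shows "blocker_safe r n (insert e C) B"
proof -
  have free: "is_free (cycle_graph (Suc r)) ({..<n}, insert e C)"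
    and eB: "e \<notin> B" and card_e: "card e = 2"
    using e by (auto simp: legal_moves_def unclaimed_def complete_graph_def all_edges_def)
  obtain p q where pq: "e = {p, q}" "p \<noteq> q" using card_e by (auto simp: card_2_iff)
  have threat: "e \<subseteq> S" if "live r n B S" "near_complete (insert e C) S" for S
  proof (rule ccontr)
    assume "\<not> e \<subseteq> S"
    then have "e \<notin> all_edges S" by (auto simp: all_edges_def)
    then have "near_complete C S"
      using that(2) unfolding near_complete_def by blast
    then show False using safe that(1) by (auto simp: constructor_safe_def)
  qed
  have "\<not> all_edges S \<subseteq> insert e C" if "live r n B S" for S
    using safe that pq unfolding constructor_safe_def near_complete_def by metis
  moreover have "S = T"
    if "live r n B S" "near_complete (insert e C) S" "live r n B T" "near_complete (insert e C) T"
    for S T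
    by (rule near_complete_unique[OF free _ \<open>r \<ge> 5\<close>])
      (use that threat[OF that(1,2)] threat[OF that(3,4)] pq in \<open>auto simp: live_def\<close>)
  ultimately show ?thesis
    using safe eB unfolding blocker_safe_def constructor_safe_def by blast
qed

lemma blocker_has_safe_move:
  assumes safe: "blocker_safe r n C B" and ne: "unclaimed n C B \<noteq> {}"
  obtains e where "e \<in> unclaimed n C B" "constructor_safe r n C (insert e B)"
proof (cases "\<exists>S. live r n B S \<and> near_complete C S")
  case True
  then obtain S where S: "live r n B S" "near_complete C S" by blast
  then obtain e where e: "e \<in> all_edges S" "e \<notin> C"
    using safe unfolding blocker_safe_def by blast
  have "e \<in> unclaimed n C B"
    using S e by (auto simp: unclaimed_def live_def complete_graph_def all_edges_def)
  moreover have "constructor_safe r n C (insert e B)"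
    unfolding constructor_safe_def
  proof (intro conjI allI impI notI)
    show "C \<inter> insert e B = {}" using safe e by (auto simp: blocker_safe_def)
    fix T assume T: "live r n (insert e B) T" "near_complete C T"
    then have "live r n B T" by (auto simp: live_def)
    then have "T = S" using safe S T(2) unfolding blocker_safe_def by blast
    then show False using T(1) e by (auto simp: live_def)
  qed
  ultimately show thesis by (rule that)
next
  case False
  obtain e where e: "e \<in> unclaimed n C B" using ne by blast
  have "constructor_safe r n C (insert e B)"
    using False safe e by (auto simp: constructor_safe_def blocker_safe_def live_def unclaimed_def)
  with e show thesis by (rule that)
qed

lemma constructor_value_safe:
  assumes "r \<ge> 5" "constructor_safe r n C B"
  shows "constructor_value (complete_graph r) (cycle_graph (Suc r)) n C B = 0"
  using assms(2)
proof (induction "card (unclaimed n C B)" arbitrary: C B rule: less_induct)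
  case less
  let ?H = "complete_graph r" and ?F = "cycle_graph (Suc r)"
  have reply: "blocker_value ?H ?F n (insert e C) B = 0" if e: "e \<in> legal_moves ?F n C B" for e
  proof -
    let ?C = "insert e C"
    have safe: "blocker_safe r n ?C B"
      using constructor_move_safe[OF \<open>r \<ge> 5\<close> less.prems e] .
    show ?thesis
    proof (cases "unclaimed n ?C B = {}")
      case True
      then show ?thesis using blocker_safe_no_copies[OF safe] by (simp add: blocker_value.simps)
    next
      case False
      obtain d where d: "d \<in> unclaimed n ?C B" "constructor_safe r n ?C (insert d B)"
        using blocker_has_safe_move[OF safe False] .
      have "card (unclaimed n ?C (insert d B)) < card (unclaimed n ?C B)"
        using card_unclaimed_insert_right[OF d(1)] .
      also have "\<dots> < card (unclaimed n C B)"
        using e by (intro card_unclaimed_insert_left) (auto simp: legal_moves_def)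
      finally have "constructor_value ?H ?F n ?C (insert d B) = 0"
        using less.hyps d(2) by blast
      then have "0 \<in> (\<lambda>d. constructor_value ?H ?F n ?C (insert d B)) ` unclaimed n ?C B"
        using d(1) by (metis (no_types, lifting) imageI)
      then have "(MIN d\<in>unclaimed n ?C B. constructor_value ?H ?F n ?C (insert d B)) \<le> 0"
        by (intro Min_le) auto
      then show ?thesis using False by (simp add: blocker_value.simps)
    qed
  qed
  show ?case
  proof (cases "legal_moves ?F n C B = {}")
    case True
    then show ?thesis
      using blocker_safe_no_copies[OF constructor_safe_imp_blocker_safe[OF less.prems]]
      by (simp add: constructor_value.simps)
  next
    case False
    then show ?thesis using reply by (simp add: constructor_value.simps)
  qed
qed

lemma constructor_safe_start:
  assumes "r \<ge> 5"
  shows "constructor_safe r n {} {}"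
proof -
  have False if live: "live r n {} S" and near: "near_complete {} S" for S
  proof -
    obtain a b where sub: "all_edges S \<subseteq> {{a, b}}" using near by (auto simp: near_complete_def)
    have card: "card S \<ge> 5" using live assms by (simp add: live_def)
    then have "card {a, b} < card S" using card_insert_le_m1[of 2 "{b}" a] by simp
    then obtain x where x: "x \<in> S" "x \<notin> {a, b}" by (rule ex_member_outside[rotated]) auto
    have "card {x} < card S" using card by simp
    then obtain y where "y \<in> S" "y \<notin> {x}" by (rule ex_member_outside[rotated]) auto
    then show False using x sub pair_in_all_edges[of x S y] by auto
  qed
  then show ?thesis by (auto simp: constructor_safe_def)
qed

theorem theoremA1:
  fixes k n :: nat
  assumes "k \<ge> 3" and "n \<ge> 1"
  shows "game_value n (complete_graph (2 * k - 1)) (cycle_graph (2 * k)) = 0"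
proof -
  have "2 * k - 1 \<ge> 5" "2 * k = Suc (2 * k - 1)" using assms by auto
  then show ?thesis
    unfolding game_value_def by (metis constructor_safe_start constructor_value_safe)
qed

end
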